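(* Let $(X,\mathcal B,\mu)$ be a probability space, let $T:X\to X$ be a (possibly noninvertible) measure-preserving transformation, and let $f\in L^1(X,\mathcal B,\mu)$ be real-valued. Put $$A_kf=\frac1k\sum_{j=0}^{k-1} f\circ T^j\quad(k\ge 1),\qquad f^*=\sup_{k\ge 1}A_kf .$$ Let $\lambda:X\to\mathbb R$ be a measurable function that is invariant, i.e. $\lambda\circ T=\lambda$ $\mu$-a.e., and such that $\lambda^+\in L^1(X,\mathcal B,\mu)$. Then $$\int_{\{f^*>\lambda\}}(f-\lambda)\,d\mu\ \ge\ 0 .$$
   Context: $T$ measure-preserving means that $T$ is measurable and $\mu(T^{-1}B)=\mu(B)$ for all $B\in\mathcal B$. $\lambda^+=\max(\lambda,0)$ denotes the positive part of $\lambda$. The function $f^*$ takes values in $(-\infty,+\infty]$, and $\{f^*>\lambda\}=\{x\in X: f^*(x)>\lambda(x)\}$. Only $\lambda^+$ is assumed integrable (not $\lambda^-$), so the integral is understood as an extended-real integral with values in $(-\infty,+\infty]$; it is well defined because the negative part of $f-\lambda$ is bounded by the integrable function $|f|+\lambda^+$. If $\lambda$ is not integrable on $\{f^*>\lambda\}$, the integral equals $+\infty$. *)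

theory Defs
  imports "HOL-Probability.Probability"
begin

definition measure_preserving_map :: "'a measure \<Rightarrow> ('a \<Rightarrow> 'a) \<Rightarrow> bool" where
  "measure_preserving_map M T \<longleftrightarrow>
     T \<in> measurable M M \<and> (\<forall>B\<in>sets M. emeasure M (T -` B \<inter> space M) = emeasure M B)"

definition ergodic_avg :: "('a \<Rightarrow> 'a) \<Rightarrow> ('a \<Rightarrow> real) \<Rightarrow> nat \<Rightarrow> 'a \<Rightarrow> real" where
  "ergodic_avg T f k x = (1 / real k) * (\<Sum>j<k. f ((T ^^ j) x))"

definition ergodic_maximal :: "('a \<Rightarrow> 'a) \<Rightarrow> ('a \<Rightarrow> real) \<Rightarrow> 'a \<Rightarrow> ereal" where
  "ergodic_maximal T f x = (SUP k\<in>{1..}. ereal (ergodic_avg T f k x))"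

(* Integral over A as (positive part) - (negative part): ennreal truncates negative reals to 0.
   It is meaningful when the negative part is finite; otherwise the convention
   \<infinity> - \<infinity> = \<infinity> of ereal could intervene. Finiteness for the integrand f - lam is shown in
   neg_part_finite, agreement with the Bochner integral in ext_set_integral_eq. *)
definition ext_set_integral :: "'a measure \<Rightarrow> 'a set \<Rightarrow> ('a \<Rightarrow> real) \<Rightarrow> ereal" where
  "ext_set_integral M A g =
     enn2ereal (\<integral>\<^sup>+x\<in>A. ennreal (g x) \<partial>M) - enn2ereal (\<integral>\<^sup>+x\<in>A. ennreal (- g x) \<partial>M)"

lemma neg_part_finite:
  fixes f lam :: "'a \<Rightarrow> real"
  assumes f: "integrable M f" and lam: "integrable M (\<lambda>x. max (lam x) 0)"
  shows "(\<integral>\<^sup>+x\<in>A. ennreal (- (f x - lam x)) \<partial>M) < \<infinity>"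
proof -
  have int: "integrable M (\<lambda>x. \<bar>f x\<bar> + max (lam x) 0)"
    using f lam by simp
  have "(\<integral>\<^sup>+x\<in>A. ennreal (- (f x - lam x)) \<partial>M) \<le> (\<integral>\<^sup>+x. ennreal (\<bar>f x\<bar> + max (lam x) 0) \<partial>M)"
  proof (rule nn_integral_mono)
    fix x
    have "- (f x - lam x) \<le> \<bar>f x\<bar> + max (lam x) 0"
      by linarith
    then show "ennreal (- (f x - lam x)) * indicator A x \<le> ennreal (\<bar>f x\<bar> + max (lam x) 0)"
      by (cases "x \<in> A") (simp_all only: indicator_simps if_True if_False not_False_eq_True mult_1_right mult_zero_right zero_le ennreal_leI)
  qed
  also have "\<dots> = ennreal (\<integral>x. \<bar>f x\<bar> + max (lam x) 0 \<partial>M)"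
    by (rule nn_integral_eq_integral[OF int]) simp
  also have "\<dots> < \<infinity>"
    by simp
  finally show ?thesis .
qed

lemma ext_set_integral_eq:
  assumes "set_integrable M A g"
  shows "ext_set_integral M A g = ereal (set_lebesgue_integral M A g)"
proof -
  let ?h = "\<lambda>x. indicator A x * g x"
  have h: "integrable M ?h"
    using assms by (simp add: set_integrable_def)
  have p: "(\<integral>\<^sup>+x\<in>A. ennreal (g x) \<partial>M) = (\<integral>\<^sup>+x. ennreal (?h x) \<partial>M)"
    "(\<integral>\<^sup>+x\<in>A. ennreal (- g x) \<partial>M) = (\<integral>\<^sup>+x. ennreal (- ?h x) \<partial>M)"
    by (auto intro!: nn_integral_cong simp: indicator_def)
  have fin: "(\<integral>\<^sup>+x. ennreal (?h x) \<partial>M) \<noteq> \<infinity>" "(\<integral>\<^sup>+x. ennreal (- ?h x) \<partial>M) \<noteq> \<infinity>"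
    using h unfolding real_integrable_def by blast+
  obtain a b where ab: "0 \<le> a" "0 \<le> b" "(\<integral>\<^sup>+x. ennreal (?h x) \<partial>M) = ennreal a"
    "(\<integral>\<^sup>+x. ennreal (- ?h x) \<partial>M) = ennreal b"
    using fin by (cases "\<integral>\<^sup>+x. ennreal (?h x) \<partial>M"; cases "\<integral>\<^sup>+x. ennreal (- ?h x) \<partial>M") auto
  have "(\<integral>x. ?h x \<partial>M) = a - b"
    using real_lebesgue_integral_def[OF h] ab by simp
  then show ?thesis
    using ab by (simp add: ext_set_integral_def p set_lebesgue_integral_def)
qed

end

theory Submission
  imports Defs
begin

text \<open>
  Let \<open>F\<^sub>n\<close> (\<open>max_birkhoff T h n\<close>) be the maximum of the Birkhoff sums of \<open>h\<close> of
  lengths \<open>0, \<dots>, n\<close>. Where it is positive, \<open>h \<ge> F\<^sub>n - F\<^sub>n \<circ> T\<close>, and integrating this gives the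
  maximal inequality (Garsia's argument) for integrable \<open>h\<close>. For the theorem, \<open>f - lam\<close> need not be
  integrable, but its restriction to the almost invariant set \<open>{lam \<ge> -N}\<close> is;
  monotone convergence, applied separately to the positive and negative parts, lets \<open>N \<rightarrow> \<infinity>\<close>.
\<close>

text \<open>Each set integral is the value of the measure \<open>density M w\<close>, which is
  continuous along increasing sets. Comparing nonnegative integrals keeps both limits meaningful
  even when they are infinite.\<close>

lemma set_nn_integral_UN_mono:
  fixes u v :: "'a \<Rightarrow> ennreal" and A :: "nat \<Rightarrow> 'a set"
  assumes u: "u \<in> borel_measurable M" and v: "v \<in> borel_measurable M"
    and A: "\<And>n. A n \<in> sets M" and inc: "incseq A"
    and le: "\<And>n. (\<integral>\<^sup>+x\<in>A n. u x \<partial>M) \<le> (\<integral>\<^sup>+x\<in>A n. v x \<partial>M)"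
  shows "(\<integral>\<^sup>+x\<in>(\<Union>n. A n). u x \<partial>M) \<le> (\<integral>\<^sup>+x\<in>(\<Union>n. A n). v x \<partial>M)"
proof -
  have lim: "(\<integral>\<^sup>+x\<in>(\<Union>n. A n). w x \<partial>M) = (SUP n. \<integral>\<^sup>+x\<in>A n. w x \<partial>M)"
    if w: "w \<in> borel_measurable M" for w :: "'a \<Rightarrow> ennreal"
  proof -
    have "(SUP n. emeasure (density M w) (A n)) = emeasure (density M w) (\<Union>n. A n)"
      using A inc by (intro SUP_emeasure_incseq) auto
    then show ?thesis
      using A w by (simp add: emeasure_density sets.countable_UN)
  qed
  show ?thesis
    unfolding lim[OF u] lim[OF v] using le by (intro SUP_mono) auto
qed

lemma measure_preserving_map_measurable:
  "measure_preserving_map M T \<Longrightarrow> T \<in> measurable M M"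
  by (simp add: measure_preserving_map_def)

text \<open>As an equality of measures, invariance lets facts about \<open>distr\<close> transfer
  null sets, integrability and integrals along \<open>T\<close>.\<close>

lemma measure_preserving_map_distr:
  assumes "measure_preserving_map M T"
  shows "distr M M T = M"
  using assms
  by (intro measure_eqI) (auto simp: measure_preserving_map_def emeasure_distr)

lemma measurable_funpow:
  assumes "T \<in> measurable M M"
  shows "(T ^^ n) \<in> measurable M M"
proof (induction n)
  case (Suc n)
  then show ?case using assms by (simp add: measurable_comp)
qed simp

lemma AE_measure_preserving_compose:
  assumes T: "measure_preserving_map M T" and P: "AE x in M. P x"
  shows "AE x in M. P (T x)"
proof (rule AE_distrD[OF measure_preserving_map_measurable[OF T]])
  show "AE x in distr M M T. P x"
    unfolding measure_preserving_map_distr[OF T] by (rule P)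
qed

text \<open>Preimages of null sets under \<open>T\<close> are null, and only countably many
  \<open>n\<close> occur, so a single null set serves whole orbits.\<close>

lemma AE_invariant_funpow:
  assumes T: "measure_preserving_map M T" and inv: "AE x in M. u (T x) = u x"
  shows "AE x in M. \<forall>n. u ((T ^^ n) x) = u x"
  unfolding AE_all_countable
proof
  fix n
  show "AE x in M. u ((T ^^ n) x) = u x"
  proof (induction n)
    case (Suc n)
    from AE_measure_preserving_compose[OF T Suc] inv show ?case
      by eventually_elim (simp add: funpow_swap1)
  qed simp
qed

lemma
  fixes u :: "'a \<Rightarrow> real"
  assumes T: "measure_preserving_map M T" and u: "integrable M u"
  shows integrable_measure_preserving_compose: "integrable M (\<lambda>x. u (T x))"
    and integral_measure_preserving_compose: "(\<integral>x. u (T x) \<partial>M) = (\<integral>x. u x \<partial>M)"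
  using integrable_distr_eq[OF measure_preserving_map_measurable[OF T], of u]
    integral_distr[OF measure_preserving_map_measurable[OF T], of u] u
  by (simp_all add: measure_preserving_map_distr[OF T])

text \<open>The recursion splits off the first term: a nonempty sum at \<open>x\<close> is
  \<open>h x\<close> plus a shorter sum at \<open>T x\<close>, and 0 is the empty sum. In this form
  integrability and Garsia's pointwise bound follow without handling a maximum over a finite
  set.\<close>

fun max_birkhoff :: "('a \<Rightarrow> 'a) \<Rightarrow> ('a \<Rightarrow> real) \<Rightarrow> nat \<Rightarrow> 'a \<Rightarrow> real" where
  "max_birkhoff T h 0 x = 0"
| "max_birkhoff T h (Suc n) x = max 0 (h x + max_birkhoff T h n (T x))"

lemma max_birkhoff_nonneg: "0 \<le> max_birkhoff T h n x"
  by (cases n) auto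

lemma max_birkhoff_Suc_mono: "max_birkhoff T h n x \<le> max_birkhoff T h (Suc n) x"
proof (induction n arbitrary: x)
  case (Suc n)
  from Suc[of "T x"] show ?case by (auto simp: max_def)
qed simp

lemma birkhoff_sum_Suc:
  "(\<Sum>j<Suc k. h ((T ^^ j) x)) = h x + (\<Sum>j<k. h ((T ^^ j) (T x)))"
  for h :: "'a \<Rightarrow> real"
  by (simp add: sum.lessThan_Suc_shift funpow_swap1 del: sum.lessThan_Suc)

lemma birkhoff_sum_le_max_birkhoff: "(\<Sum>j<k. h ((T ^^ j) x)) \<le> max_birkhoff T h k x"
proof (induction k arbitrary: x)
  case (Suc k)
  from Suc[of "T x"] show ?case
    unfolding birkhoff_sum_Suc by simp
qed simp

lemma max_birkhoff_attained: "\<exists>k\<le>n. max_birkhoff T h n x = (\<Sum>j<k. h ((T ^^ j) x))"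
proof (induction n arbitrary: x)
  case (Suc n)
  then obtain k where k: "k \<le> n" "max_birkhoff T h n (T x) = (\<Sum>j<k. h ((T ^^ j) (T x)))"
    by blast
  show ?case
  proof (cases "h x + max_birkhoff T h n (T x) \<le> 0")
    case True
    then show ?thesis by (intro exI[of _ 0]) simp
  next
    case False
    then show ?thesis
      using k by (intro exI[of _ "Suc k"]) (simp add: birkhoff_sum_Suc del: sum.lessThan_Suc)
  qed
qed simp

lemma ex_max_birkhoff_pos_iff:
  "(\<exists>n. 0 < max_birkhoff T h n x) \<longleftrightarrow> (\<exists>k\<ge>1. 0 < (\<Sum>j<k. h ((T ^^ j) x)))"
proof
  assume "\<exists>n. 0 < max_birkhoff T h n x"
  then obtain n where "0 < max_birkhoff T h n x" ..
  moreover obtain k where "max_birkhoff T h n x = (\<Sum>j<k. h ((T ^^ j) x))"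
    using max_birkhoff_attained[where T = T and h = h and n = n and x = x] by auto
  ultimately have "0 < (\<Sum>j<k. h ((T ^^ j) x))" by simp
  \<comment> \<open>The empty sum is 0, so it cannot attain a positive maximum.\<close>
  moreover from this have "k \<ge> 1" by (cases k) auto
  ultimately show "\<exists>k\<ge>1. 0 < (\<Sum>j<k. h ((T ^^ j) x))" by blast
next
  assume "\<exists>k\<ge>1. 0 < (\<Sum>j<k. h ((T ^^ j) x))"
  then obtain k where "0 < (\<Sum>j<k. h ((T ^^ j) x))" by blast
  then have "0 < max_birkhoff T h k x"
    using birkhoff_sum_le_max_birkhoff by (rule less_le_trans)
  then show "\<exists>n. 0 < max_birkhoff T h n x" ..
qed

lemma integrable_max_birkhoff:
  assumes T: "measure_preserving_map M T" and h: "integrable M h"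
  shows "integrable M (max_birkhoff T h n)"
proof (induction n)
  case (Suc n)
  from integrable_measure_preserving_compose[OF T Suc] h show ?case by simp
qed simp

lemma maximal_inequality_finite:
  assumes T: "measure_preserving_map M T" and h: "integrable M h"
  defines "A \<equiv> \<lambda>n. {x \<in> space M. 0 < max_birkhoff T h n x}"
  shows "0 \<le> (\<integral>x. indicator (A n) x * h x \<partial>M)"
proof -
  let ?F = "max_birkhoff T h n"
  note F = integrable_max_birkhoff[OF T h, of n]
  note FT = integrable_measure_preserving_compose[OF T F]
  have [measurable]: "A n \<in> sets M"
    unfolding A_def using borel_measurable_integrable[OF F] by measurable
  \<comment> \<open>Invariance of the measure makes \<open>?F\<close> and its composition with
    \<open>T\<close> have the same integral.\<close>
  have "0 = (\<integral>x. ?F x - ?F (T x) \<partial>M)"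
    using integral_measure_preserving_compose[OF T F] F FT by simp
  also have "\<dots> \<le> (\<integral>x. indicator (A n) x * h x \<partial>M)"
  proof (rule integral_mono)
    show "integrable M (\<lambda>x. ?F x - ?F (T x))" using F FT by simp
    show "integrable M (\<lambda>x. indicator (A n) x * h x)"
      using integrable_mult_indicator[OF _ h, of "A n"] by simp
  next
    fix x assume x: "x \<in> space M"
    show "?F x - ?F (T x) \<le> indicator (A n) x * h x"
    proof (cases "0 < ?F x")
      case True
      \<comment> \<open>Positivity excludes \<open>n = 0\<close> and selects the second argument of
        \<open>max\<close> in the recursion.\<close>
      then obtain m where m: "n = Suc m" by (cases n) auto
      then have "?F x = h x + max_birkhoff T h m (T x)"
        using True by (auto simp: max_def split: if_splits)
      also have "\<dots> \<le> h x + ?F (T x)"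
        using max_birkhoff_Suc_mono[of T h m "T x"] m by simp
      finally show ?thesis using True x by (simp add: A_def)
    next
      \<comment> \<open>Off \<open>A n\<close> the right side is 0, while the left side is minus a
        nonnegative value.\<close>
      case False
      then have "?F x = 0" using max_birkhoff_nonneg[of T h n x] by linarith
      then show ?thesis using max_birkhoff_nonneg[of T h n "T x"] by (simp add: A_def)
    qed
  qed
  finally show ?thesis .
qed

text \<open>Splits a Bochner integral into its two parts. The resulting inequality, unlike the
  integral itself, passes to limits where the positive part may become infinite.\<close>

lemma set_nn_integral_neg_le_pos:
  fixes h :: "'a \<Rightarrow> real"
  assumes h: "integrable M h" and A: "A \<in> sets M"
    and nonneg: "0 \<le> (\<integral>x. indicator A x * h x \<partial>M)"
  shows "(\<integral>\<^sup>+x\<in>A. ennreal (- h x) \<partial>M) \<le> (\<integral>\<^sup>+x\<in>A. ennreal (h x) \<partial>M)"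
proof -
  have int: "set_integrable M A h"
    unfolding set_integrable_def using integrable_mult_indicator[OF A h] .
  let ?p = "\<lambda>x. indicator A x * max (h x) 0" and ?q = "\<lambda>x. indicator A x * max (- h x) 0"
  have p: "integrable M ?p" and q: "integrable M ?q"
    using integrable_mult_indicator[OF A, of "\<lambda>x. max (h x) 0"]
      integrable_mult_indicator[OF A, of "\<lambda>x. max (- h x) 0"] h by simp_all
  have "(\<integral>x. indicator A x * h x \<partial>M) = (\<integral>x. ?p x - ?q x \<partial>M)"
    by (intro Bochner_Integration.integral_cong) (auto simp: indicator_def)
  then have le: "(\<integral>x. ?q x \<partial>M) \<le> (\<integral>x. ?p x \<partial>M)"
    using nonneg p q by simp
  have "(\<integral>\<^sup>+x\<in>A. ennreal (- h x) \<partial>M) = (\<integral>\<^sup>+x. ennreal (?q x) \<partial>M)"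
    by (intro nn_integral_cong) (auto simp: indicator_def max_def ennreal_neg)
  also have "\<dots> = ennreal (\<integral>x. ?q x \<partial>M)"
    by (intro nn_integral_eq_integral q) auto
  also have "\<dots> \<le> ennreal (\<integral>x. ?p x \<partial>M)"
    by (rule ennreal_leI[OF le])
  also have "\<dots> = (\<integral>\<^sup>+x. ennreal (?p x) \<partial>M)"
    by (intro nn_integral_eq_integral[symmetric] p) auto
  also have "\<dots> = (\<integral>\<^sup>+x\<in>A. ennreal (h x) \<partial>M)"
    by (intro nn_integral_cong) (auto simp: indicator_def max_def ennreal_neg)
  finally show ?thesis .
qed

lemma maximal_inequality:
  assumes T: "measure_preserving_map M T" and h: "integrable M h"
  defines "E \<equiv> {x \<in> space M. \<exists>k\<ge>1. 0 < (\<Sum>j<k. h ((T ^^ j) x))}"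
  shows "(\<integral>\<^sup>+x\<in>E. ennreal (- h x) \<partial>M) \<le> (\<integral>\<^sup>+x\<in>E. ennreal (h x) \<partial>M)"
proof -
  define A where "A = (\<lambda>n. {x \<in> space M. 0 < max_birkhoff T h n x})"
  have E: "E = (\<Union>n. A n)"
    unfolding E_def A_def ex_max_birkhoff_pos_iff[symmetric] by blast
  have [measurable]: "h \<in> borel_measurable M" using h by simp
  have A: "A n \<in> sets M" for n
    unfolding A_def
    using borel_measurable_integrable[OF integrable_max_birkhoff[OF T h, of n]] by measurable
  have inc: "incseq A"
    unfolding A_def
    by (intro incseq_SucI) (auto intro: less_le_trans[OF _ max_birkhoff_Suc_mono]
      simp del: max_birkhoff.simps)
  show ?thesis
    unfolding E
  proof (rule set_nn_integral_UN_mono[OF _ _ A inc])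
    show "(\<integral>\<^sup>+x\<in>A n. ennreal (- h x) \<partial>M) \<le> (\<integral>\<^sup>+x\<in>A n. ennreal (h x) \<partial>M)" for n
      using maximal_inequality_finite[OF T h]
      by (intro set_nn_integral_neg_le_pos[OF h A]) (simp add: A_def)
  qed simp_all
qed

text \<open>A supremum exceeds \<open>c\<close> iff some average does, and \<open>k \<ge> 1\<close>
  permits clearing the denominator. The countable quantifier also yields measurability of the
  superlevel set.\<close>

lemma ergodic_maximal_gt_iff:
  "ereal c < ergodic_maximal T f x \<longleftrightarrow> (\<exists>k\<ge>1. real k * c < (\<Sum>j<k. f ((T ^^ j) x)))"
  unfolding ergodic_maximal_def ergodic_avg_def less_SUP_iff Bex_def
  by (intro ex_cong1) (auto simp: field_simps Suc_le_eq)

theorem mainTheorem1: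
  fixes M :: "'a measure" and T :: "'a \<Rightarrow> 'a" and f lam :: "'a \<Rightarrow> real"
  assumes "prob_space M"
    and "measure_preserving_map M T"
    and "integrable M f"
    and "lam \<in> borel_measurable M"
    and "AE x in M. lam (T x) = lam x"
    and "integrable M (\<lambda>x. max (lam x) 0)"
  shows "ext_set_integral M {x \<in> space M. ergodic_maximal T f x > ereal (lam x)} (\<lambda>x. f x - lam x) \<ge> 0"
proof -
  interpret prob_space M by fact
  note T = assms(2) and f = assms(3) and [measurable] = assms(4) and lam_pos = assms(6)
  have [measurable]: "f \<in> borel_measurable M" using f by simp
  have [measurable]: "(T ^^ j) \<in> measurable M M" for j
    by (intro measurable_funpow measure_preserving_map_measurable T)
  let ?g = "\<lambda>x. f x - lam x"
  define E where "E = {x \<in> space M. ergodic_maximal T f x > ereal (lam x)}"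
  define B where "B = (\<lambda>N::nat. {x \<in> space M. - real N \<le> lam x})"
  have [measurable]: "E \<in> sets M"
    unfolding E_def ergodic_maximal_gt_iff by measurable
  have [measurable]: "B N \<in> sets M" for N
    unfolding B_def by measurable
  have UN: "(\<Union>N. E \<inter> B N) = E"
  proof -
    have "\<exists>N. - real N \<le> lam x" for x
      using real_arch_simple[of "- lam x"] by (metis minus_le_iff)
    then show ?thesis by (auto simp: B_def E_def)
  qed
  have inc: "incseq (\<lambda>N. E \<inter> B N)"
    by (intro incseq_SucI) (auto simp: B_def)
  have trunc: "(\<integral>\<^sup>+x\<in>E \<inter> B N. ennreal (- ?g x) \<partial>M) \<le> (\<integral>\<^sup>+x\<in>E \<inter> B N. ennreal (?g x) \<partial>M)" for N
  proof -
    \<comment> \<open>Where \<open>- real N \<le> lam x\<close>, the absolute value of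
      \<open>lam x\<close> is at most \<open>max (lam x) 0 + real N\<close>. This gives an
      integrable bound for \<open>h\<close>, as constants are integrable on a probability
      space.\<close>
    define h where "h = (\<lambda>x. if - real N \<le> lam x then ?g x else 0)"
    define E' where "E' = {x \<in> space M. \<exists>k\<ge>1. 0 < (\<Sum>j<k. h ((T ^^ j) x))}"
    have h: "integrable M h"
    proof (rule Bochner_Integration.integrable_bound)
      show "integrable M (\<lambda>x. \<bar>f x\<bar> + max (lam x) 0 + real N)"
        using f lam_pos by simp
      show "h \<in> borel_measurable M" unfolding h_def by measurable
      show "AE x in M. norm (h x) \<le> norm (\<bar>f x\<bar> + max (lam x) 0 + real N)"
        by (intro AE_I2) (auto simp: h_def)
    qed
    \<comment> \<open>Along almost every orbit \<open>lam\<close> is constant, so either every term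
      is truncated or none is.\<close>
    have sum_h: "AE x in M. \<forall>k. (\<Sum>j<k. h ((T ^^ j) x)) =
        (if - real N \<le> lam x then (\<Sum>j<k. f ((T ^^ j) x)) - real k * lam x else 0)"
      using AE_invariant_funpow[OF T assms(5)]
      by eventually_elim (simp add: h_def sum_subtractf)
    \<comment> \<open>Outside \<open>B N\<close> all sums of \<open>h\<close> vanish, so the strict
      inequality in \<open>E'\<close> fails; on \<open>B N\<close> it is the one characterizing
      \<open>E\<close>.\<close>
    have E': "AE x in M. x \<in> E' \<longleftrightarrow> x \<in> E \<inter> B N"
      using sum_h AE_space
    proof eventually_elim
      case (elim x)
      then show ?case
        by (auto simp: E'_def E_def B_def ergodic_maximal_gt_iff)
    qed
    have "(\<integral>\<^sup>+x\<in>E \<inter> B N. ennreal (- ?g x) \<partial>M) = (\<integral>\<^sup>+x\<in>E'. ennreal (- h x) \<partial>M)"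
      using E' by (intro nn_integral_cong_AE, eventually_elim)
        (auto simp: h_def B_def indicator_def)
    also have "\<dots> \<le> (\<integral>\<^sup>+x\<in>E'. ennreal (h x) \<partial>M)"
      unfolding E'_def by (rule maximal_inequality[OF T h])
    also have "\<dots> = (\<integral>\<^sup>+x\<in>E \<inter> B N. ennreal (?g x) \<partial>M)"
      using E' by (intro nn_integral_cong_AE, eventually_elim)
        (auto simp: h_def B_def indicator_def)
    finally show ?thesis .
  qed
  have "(\<integral>\<^sup>+x\<in>E. ennreal (- ?g x) \<partial>M) \<le> (\<integral>\<^sup>+x\<in>E. ennreal (?g x) \<partial>M)"
    using set_nn_integral_UN_mono[OF _ _ _ inc trunc] unfolding UN by simp
  \<comment> \<open>The positive part may be infinite; the comparison of the parts still makes their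
    \<open>ereal\<close> difference nonnegative.\<close>
  then show ?thesis
    unfolding ext_set_integral_def E_def[symmetric]
    by (intro ereal_diff_positive) (simp add: less_eq_ennreal.rep_eq)
qed

end
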